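(* Let $n\ge2$ and let $(m_{i,j})_{0\le i,j\le n}$ be the change of basis matrix from the shifted Legendre polynomials to the Bernstein polynomials, i.e. $P_j^*(x)=\sum_{i=0}^n m_{i,j}\,b_i^n(x)$. Then for every column index $0\le j\le n$ and every $0\le i\le n-2$, $$-(1+i)(i-n)\,m_{i,j}+(2+4i+2i^2+j+j^2-3n-2in)\,m_{i+1,j}-(2+i)(1+i-n)\,m_{i+2,j}=0.$$
   Context: $P_j^*(x)=P_j(2x-1)$ where $P_j$ is the Legendre polynomial; $b_i^n(x)=\binom{n}{i}x^i(1-x)^{n-i}$. *)

theory Defs
  imports "HOL-Analysis.Weierstrass_Theorems" "HOL-Computational_Algebra.Polynomial"
begin

text \<open>Legendre polynomials by Rodrigues' formula, normalised so that they take the value 1 at 1.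
  The Bernstein polynomial $b_i^n(x)$ is the library's \<open>Bernstein n i x\<close>.\<close>

definition legendre_poly :: "nat \<Rightarrow> real poly" where
  "legendre_poly j = smult (1 / (2 ^ j * fact j)) ((pderiv ^^ j) ([:-1, 0, 1:] ^ j))"

definition shifted_legendre_poly :: "nat \<Rightarrow> real poly" where
  "shifted_legendre_poly j = pcompose (legendre_poly j) [:-1, 2:]"

definition legendre_to_bernstein :: "nat \<Rightarrow> (nat \<Rightarrow> nat \<Rightarrow> real) \<Rightarrow> bool" where
  "legendre_to_bernstein n m \<longleftrightarrow>
     (\<forall>j\<le>n. \<forall>x. poly (shifted_legendre_poly j) x = (\<Sum>i=0..n. m i j * Bernstein n i x))"

end

theory Submission imports Defs begin

text \<open>
  Write \<open>L p = (x (1 - x) p')'\<close>. The shifted Legendre polynomial \<open>P\<close> of degree \<open>j\<close> is an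
  eigenfunction: \<open>L P = - j (j + 1) P\<close>. In the unnormalised Bernstein basis
  \<open>x ^ k (1 - x) ^ (n - k)\<close> the operator \<open>L\<close> is tridiagonal. Comparing the coefficients of both
  sides of the eigenvalue equation at the index \<open>k = i + 1\<close> therefore links three consecutive
  coefficients of \<open>P\<close>, and this relation is the recurrence, up to the binomial factors
  that normalise the basis.

  The eigenvalue equation \<open>sturm_liouville_shifted_legendre\<close> comes from Rodrigues' formula by
  repeated differentiation; \<open>sturm_liouville_power_basis\<close> is the tridiagonal action, and
  \<open>bernstein_basis_independent\<close> allows the comparison of coefficients.
\<close>

section \<open>The differential equation of the shifted Legendre polynomials\<close>

text \<open>
  The function \<open>w = (x\<^sup>2 - 1) ^ j\<close> satisfies \<open>(x\<^sup>2 - 1) w' = 2 j x w\<close>. Differentiating this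
  \<open>k + 1\<close> times gives the claim; the induction performs one differentiation per step, and it
  starts from the once differentiated equation so that no derivative of order \<open>k - 1\<close> occurs.
\<close>

lemma rodrigues_iterated_derivative:
  fixes j k :: nat
  defines "w \<equiv> [:-1, 0, 1:] ^ j :: real poly"
  shows "[:-1, 0, 1:] * (pderiv ^^ (k + 2)) w
       + smult (2 * (real k + 1 - real j)) ([:0, 1:] * (pderiv ^^ (k + 1)) w)
       + smult ((real k + 1) * (real k - 2 * real j)) ((pderiv ^^ k) w) = 0"
proof (induction k)
  case 0
  have first_order: "[:-1, 0, 1:] * pderiv w = smult (2 * real j) ([:0, 1:] * w)"
    by (cases j) (simp_all add: w_def pderiv_power_Suc pderiv_pCons pderiv_1 algebra_simps
        del: power_Suc, simp add: algebra_simps)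
  have "pderiv ([:-1, 0, 1:] * pderiv w) = pderiv (smult (2 * real j) ([:0, 1:] * w))"
    by (simp only: first_order)
  then show ?case
    by (simp add: pderiv_mult pderiv_smult pderiv_pCons poly_eq_poly_eq_iff[symmetric] fun_eq_iff
        del: mult_pCons_left mult_pCons_right)
       (simp add: algebra_simps)
next
  case (Suc k)
  have "pderiv ([:-1, 0, 1:] * (pderiv ^^ (k + 2)) w
       + smult (2 * (real k + 1 - real j)) ([:0, 1:] * (pderiv ^^ (k + 1)) w)
       + smult ((real k + 1) * (real k - 2 * real j)) ((pderiv ^^ k) w)) = 0"
    by (simp only: Suc.IH pderiv_0)
  then show ?case
    by (simp add: pderiv_add pderiv_mult pderiv_smult pderiv_pCons
        poly_eq_poly_eq_iff[symmetric] fun_eq_iff del: mult_pCons_left mult_pCons_right)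
       (simp add: algebra_simps)
qed

lemma legendre_differential_equation:
  "[:-1, 0, 1:] * pderiv (pderiv (legendre_poly j)) + smult 2 ([:0, 1:] * pderiv (legendre_poly j))
     = smult (real j * (real j + 1)) (legendre_poly j)"
proof -
  define w where "w = (pderiv ^^ j) ([:-1, 0, 1:] ^ j :: real poly)"
  have "[:-1, 0, 1:] * pderiv (pderiv w) + smult 2 ([:0, 1:] * pderiv w)
      = smult (real j * (real j + 1)) w"
    using rodrigues_iterated_derivative[of j j]
    by (simp add: w_def poly_eq_poly_eq_iff[symmetric] fun_eq_iff algebra_simps)
  then have "smult (1 / (2 ^ j * fact j))
        ([:-1, 0, 1:] * pderiv (pderiv w) + smult 2 ([:0, 1:] * pderiv w))
      = smult (1 / (2 ^ j * fact j)) (smult (real j * (real j + 1)) w)"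
    by (simp only:)
  moreover have "legendre_poly j = smult (1 / (2 ^ j * fact j)) w"
    by (simp add: legendre_poly_def w_def)
  ultimately show ?thesis
    by (simp only: pderiv_smult mult_smult_right smult_add_right smult_smult mult.commute)
qed

definition sturm_liouville :: "real poly \<Rightarrow> real poly" where
  "sturm_liouville p = pderiv ([:0, 1:] * [:1, -1:] * pderiv p)"

lemma sturm_liouville_shifted_legendre:
  "sturm_liouville (shifted_legendre_poly j)
     = smult (- (real j * (real j + 1))) (shifted_legendre_poly j)"
proof -
  let ?P = "legendre_poly j"
  have "poly (sturm_liouville (shifted_legendre_poly j)) x
      = poly (smult (- (real j * (real j + 1))) (shifted_legendre_poly j)) x" for x
  proof -
    let ?t = "2 * x - 1"
    \<comment> \<open>With \<open>t = 2 x - 1\<close>, the chain rule factors are absorbed by \<open>t\<^sup>2 - 1 = - 4 x (1 - x)\<close>.\<close>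
    have "(?t\<^sup>2 - 1) * poly (pderiv (pderiv ?P)) ?t + 2 * ?t * poly (pderiv ?P) ?t
        = real j * (real j + 1) * poly ?P ?t"
      using arg_cong[OF legendre_differential_equation[of j], of "\<lambda>p. poly p ?t"]
      by (simp add: power2_eq_square algebra_simps)
    then show ?thesis
      by (simp add: sturm_liouville_def shifted_legendre_poly_def pderiv_pcompose pderiv_mult
          pderiv_pCons poly_pcompose pderiv_smult power2_eq_square
          del: mult_pCons_left mult_pCons_right)
         (simp add: algebra_simps)
  qed
  then show ?thesis
    by (simp only: poly_eq_poly_eq_iff[symmetric] fun_eq_iff) simp
qed

section \<open>The Bernstein basis\<close>

definition power_basis :: "nat \<Rightarrow> nat \<Rightarrow> real poly" where
  "power_basis k l = [:0, 1:] ^ k * [:1, -1:] ^ l"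

lemma pderiv_power_basis:
  "pderiv (power_basis k l)
     = smult (real k) (power_basis (k - 1) l) - smult (real l) (power_basis k (l - 1))"
  by (simp add: power_basis_def pderiv_mult pderiv_power pderiv_pCons mult.commute)

text \<open>
  The subtractions on natural numbers are harmless: a term in which \<open>0 - 1\<close> occurs has the
  coefficient 0.
\<close>

lemma sturm_liouville_power_basis:
  "sturm_liouville (power_basis k l)
     = smult ((real k)\<^sup>2) (power_basis (k - 1) (Suc l))
       - smult (2 * real k * real l + real k + real l) (power_basis k l)
       + smult ((real l)\<^sup>2) (power_basis (Suc k) (l - 1))"
proof -
  have X: "[:0, 1:] * smult (real k) (power_basis (k - 1) l) = smult (real k) (power_basis k l)"
    for k l by (cases k) (simp_all add: power_basis_def)
  have Y: "[:1, -1:] * smult (real l) (power_basis k (l - 1)) = smult (real l) (power_basis k l)"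
    for k l by (cases l) (simp_all add: power_basis_def algebra_simps del: mult_pCons_left mult_pCons_right)
  have X': "[:0, 1:] * power_basis k l = power_basis (Suc k) l"
    and Y': "[:1, -1:] * power_basis k l = power_basis k (Suc l)" for k l
    by (simp_all only: power_basis_def power_Suc mult_ac)
  have "[:0, 1:] * [:1, -1:] * pderiv (power_basis k l)
      = [:1, -1:] * ([:0, 1:] * smult (real k) (power_basis (k - 1) l))
        - [:0, 1:] * ([:1, -1:] * smult (real l) (power_basis k (l - 1)))"
    unfolding pderiv_power_basis right_diff_distrib by (simp only: mult_ac)
  also have "\<dots> = smult (real k) (power_basis k (Suc l)) - smult (real l) (power_basis (Suc k) l)"
    unfolding X Y by (simp only: mult_smult_right X' Y')
  finally have flow: "[:0, 1:] * [:1, -1:] * pderiv (power_basis k l) = \<dots>" .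
  show ?thesis
    unfolding sturm_liouville_def flow
    by (simp add: pderiv_diff pderiv_smult pderiv_power_basis
        poly_eq_poly_eq_iff[symmetric] fun_eq_iff)
       (simp add: algebra_simps power2_eq_square)
qed

text \<open>
  Substituting \<open>x = z / (1 + z)\<close> and multiplying by \<open>(1 + z) ^ n\<close> turns the sum into
  \<open>\<Sum>k\<le>n. d k * z ^ k\<close>, which vanishes for all \<open>z > 0\<close>.
\<close>

lemma bernstein_basis_independent:
  assumes "(\<Sum>k\<le>n. smult (d k) (power_basis k (n - k))) = 0" and "k \<le> n"
  shows "d k = 0"
proof (rule ccontr)
  assume "d k \<noteq> 0"
  have "(\<Sum>k\<le>n. d k * z ^ k) = 0" if "z > 0" for z :: real
  proof -
    define x where "x = z / (1 + z)"
    have x: "x * (1 + z) = z" "(1 - x) * (1 + z) = 1"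
      using that by (simp_all add: x_def field_simps)
    have "d k * z ^ k = (1 + z) ^ n * (d k * (x ^ k * (1 - x) ^ (n - k)))" if "k \<le> n" for k
    proof -
      have "(1 + z) ^ n = (1 + z) ^ k * (1 + z) ^ (n - k)"
        using that by (simp flip: power_add)
      then have "(1 + z) ^ n * (d k * (x ^ k * (1 - x) ^ (n - k)))
          = d k * (x * (1 + z)) ^ k * ((1 - x) * (1 + z)) ^ (n - k)"
        by (simp only: power_mult_distrib mult_ac)
      then show ?thesis by (simp only: x power_one mult_1_right)
    qed
    then have "(\<Sum>k\<le>n. d k * z ^ k)
        = (\<Sum>k\<le>n. (1 + z) ^ n * (d k * (x ^ k * (1 - x) ^ (n - k))))"
      by (intro sum.cong) auto
    also have "\<dots> = (1 + z) ^ n * poly (\<Sum>k\<le>n. smult (d k) (power_basis k (n - k))) x"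
      by (simp add: sum_distrib_left poly_sum power_basis_def)
    finally show ?thesis using assms(1) by simp
  qed
  then have "{0<..} \<subseteq> {z. (\<Sum>k\<le>n. d k * z ^ k) = 0}"
    by auto
  then have "finite {0::real<..}"
    using polyfun_roots_finite[of d, OF \<open>d k \<noteq> 0\<close> assms(2)] finite_subset by blast
  then show False by (simp add: infinite_Ioi)
qed

lemma sturm_liouville_sum:
  "sturm_liouville (\<Sum>k\<in>A. smult (a k) (p k)) = (\<Sum>k\<in>A. smult (a k) (sturm_liouville (p k)))"
  by (simp add: sturm_liouville_def higher_pderiv_sum[of 1, simplified] pderiv_smult sum_distrib_left
      del: mult_pCons_left mult_pCons_right)

lemma smult_sum_right: "smult c (\<Sum>k\<in>A. p k) = (\<Sum>k\<in>A. smult c (p k))"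
  by (induction A rule: infinite_finite_induct) (simp_all add: smult_add_right)

text \<open>
  Reindexing turns the action on basis elements into one on coefficients. It would bring in
  coefficients at the indices \<open>n + 1\<close> and \<open>-1\<close>; the assumption makes the former vanish, which
  holds automatically for multiples of \<open>n choose k\<close>, and the conditional replaces the latter by 0.
\<close>

lemma sturm_liouville_bernstein_expansion:
  assumes "a (Suc n) = 0"
  shows "sturm_liouville (\<Sum>k\<le>n. smult (a k) (power_basis k (n - k)))
    = (\<Sum>k\<le>n. smult
        (a (Suc k) * (real (Suc k))\<^sup>2
         - a k * (2 * real k * real (n - k) + real n)
         + (if k = 0 then 0 else a (k - 1) * (real (n - (k - 1)))\<^sup>2))
        (power_basis k (n - k)))"
proof -
  let ?u = "\<lambda>k. power_basis k (n - k)"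
  have "(\<Sum>k\<le>n. smult (a k * (real k)\<^sup>2) (power_basis (k - 1) (Suc (n - k))))
      = (\<Sum>k<n. smult (a (Suc k) * (real (Suc k))\<^sup>2) (?u k))"
    by (subst sum.atMost_shift) (auto intro!: sum.cong simp: Suc_diff_Suc simp del: of_nat_Suc)
  also have "\<dots> = (\<Sum>k\<le>n. smult (a (Suc k) * (real (Suc k))\<^sup>2) (?u k))"
    using assms by (simp flip: lessThan_Suc_atMost)
  finally have lower: "(\<Sum>k\<le>n. smult (a k * (real k)\<^sup>2) (power_basis (k - 1) (Suc (n - k)))) = \<dots>" .
  have "(\<Sum>k\<le>n. smult (a k * (real (n - k))\<^sup>2) (power_basis (Suc k) (n - k - 1)))
      = (\<Sum>k<n. smult (a k * (real (n - k))\<^sup>2) (?u (Suc k)))"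
    by (simp flip: lessThan_Suc_atMost)
  also have "\<dots> = (\<Sum>k\<le>n. smult (if k = 0 then 0 else a (k - 1) * (real (n - (k - 1)))\<^sup>2) (?u k))"
    by (subst sum.atMost_shift) simp
  finally have upper: "(\<Sum>k\<le>n. smult (a k * (real (n - k))\<^sup>2) (power_basis (Suc k) (n - k - 1))) = \<dots>" .
  have "sturm_liouville (\<Sum>k\<le>n. smult (a k) (?u k))
      = (\<Sum>k\<le>n. smult (a k * (real k)\<^sup>2) (power_basis (k - 1) (Suc (n - k))))
        - (\<Sum>k\<le>n. smult (a k * (2 * real k * real (n - k) + real n)) (?u k))
        + (\<Sum>k\<le>n. smult (a k * (real (n - k))\<^sup>2) (power_basis (Suc k) (n - k - 1)))"
    unfolding sturm_liouville_sum sturm_liouville_power_basis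
    by (simp add: smult_add_right smult_diff_right sum.distrib sum_subtractf add.assoc
        flip: of_nat_add)
  then show ?thesis
    unfolding lower upper by (simp only: smult_add_left smult_diff_left sum.distrib sum_subtractf)
qed

lemma legendre_bernstein_expansion:
  assumes "legendre_to_bernstein n m" and "j \<le> n"
  shows "shifted_legendre_poly j
    = (\<Sum>k\<le>n. smult (m k j * real (n choose k)) (power_basis k (n - k)))"
proof -
  have "poly (shifted_legendre_poly j) x
      = poly (\<Sum>k\<le>n. smult (m k j * real (n choose k)) (power_basis k (n - k))) x" for x
    using assms by (simp add: legendre_to_bernstein_def poly_sum power_basis_def Bernstein_def
        atMost_atLeast0 mult.assoc)
  then show ?thesis
    by (simp only: poly_eq_poly_eq_iff[symmetric] fun_eq_iff) simp
qed

section \<open>The recurrence\<close>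

theorem mainTheorem12:
  fixes n i j :: nat and m :: "nat \<Rightarrow> nat \<Rightarrow> real"
  assumes "n \<ge> 2"
    and "legendre_to_bernstein n m"
    and "j \<le> n"
    and "i \<le> n - 2"
  shows "- (1 + real i) * (real i - real n) * m i j
     + (2 + 4 * real i + 2 * (real i)\<^sup>2 + real j + (real j)\<^sup>2 - 3 * real n - 2 * real i * real n)
         * m (i + 1) j
     - (2 + real i) * (1 + real i - real n) * m (i + 2) j = 0"
proof -
  define a where "a k = m k j * real (n choose k)" for k
  define c where "c = real (n choose Suc i)"
  have i: "Suc i < n" using assms(1,4) by simp
  have P: "shifted_legendre_poly j = (\<Sum>k\<le>n. smult (a k) (power_basis k (n - k)))"
    using legendre_bernstein_expansion[OF assms(2,3)] by (simp add: a_def)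
  have "a (Suc n) = 0" by (simp add: a_def)
  define d where "d k = a (Suc k) * (real (Suc k))\<^sup>2
      - a k * (2 * real k * real (n - k) + real n)
      + (if k = 0 then 0 else a (k - 1) * (real (n - (k - 1)))\<^sup>2)
      + real j * (real j + 1) * a k" for k
  have "sturm_liouville (shifted_legendre_poly j)
      + smult (real j * (real j + 1)) (shifted_legendre_poly j) = 0"
    by (simp add: sturm_liouville_shifted_legendre)
  then have "(\<Sum>k\<le>n. smult (d k) (power_basis k (n - k))) = 0"
    unfolding P sturm_liouville_bernstein_expansion[of a, OF \<open>a (Suc n) = 0\<close>] smult_sum_right smult_smult
    by (simp only: d_def smult_add_left sum.distrib)
  then have "d (Suc i) = 0"
    using i by (intro bernstein_basis_independent) auto
  then have rec: "a (Suc (Suc i)) * (real i + 2)\<^sup>2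
      - a (Suc i) * (2 * (real i + 1) * (real n - real i - 1) + real n)
      + a i * (real n - real i)\<^sup>2 + real j * (real j + 1) * a (Suc i) = 0"
    using i by (simp add: d_def of_nat_diff algebra_simps)
  have absorb: "real (Suc k) * real (n choose Suc k) = real (n - k) * real (n choose k)" for k
    by (simp only: of_nat_mult[symmetric] binomial_absorption binomial_absorb_comp)
  have down: "real (n choose i) * (real n - real i) = c * (real i + 1)"
    using absorb[of i] i by (simp add: c_def of_nat_diff algebra_simps)
  have up: "real (n choose Suc (Suc i)) * (real i + 2) = c * (real n - real i - 1)"
    using absorb[of "Suc i"] i by (simp add: c_def of_nat_diff algebra_simps)
  have "a (Suc (Suc i)) * (real i + 2)\<^sup>2
      = m (i + 2) j * (real i + 2) * (real (n choose Suc (Suc i)) * (real i + 2))"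
    by (simp add: a_def power2_eq_square)
  then have upper: "a (Suc (Suc i)) * (real i + 2)\<^sup>2
      = c * ((real i + 2) * (real n - real i - 1) * m (i + 2) j)"
    unfolding up by (simp only: mult_ac)
  have "a i * (real n - real i)\<^sup>2
      = m i j * (real n - real i) * (real (n choose i) * (real n - real i))"
    by (simp add: a_def power2_eq_square)
  then have lower: "a i * (real n - real i)\<^sup>2
      = c * ((real i + 1) * (real n - real i) * m i j)"
    unfolding down by (simp only: mult_ac)
  have "a (Suc i) = c * m (i + 1) j"
    by (simp add: a_def c_def)
  with rec upper lower have "c * (- (1 + real i) * (real i - real n) * m i j
     + (2 + 4 * real i + 2 * (real i)\<^sup>2 + real j + (real j)\<^sup>2 - 3 * real n - 2 * real i * real n)
         * m (i + 1) j
     - (2 + real i) * (1 + real i - real n) * m (i + 2) j) = 0"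
    by (simp add: algebra_simps power2_eq_square)
  moreover have "c \<noteq> 0" using i by (simp add: c_def)
  ultimately show ?thesis by simp
qed

end
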